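(* Let $S$ be a finite alphabet with $|S| \geq 2$. Then $\mathrm{sub}_m(\mathrm{End}(S^{\mathbb{Z}}))$ is closed under direct products; that is, if $M$ and $N$ are monoids with $M \leq \mathrm{End}(S^{\mathbb{Z}})$ and $N \leq \mathrm{End}(S^{\mathbb{Z}})$, then $M \times N \leq \mathrm{End}(S^{\mathbb{Z}})$.
   Context: For a finite alphabet $S$, $S^{\mathbb{Z}}$ (the full shift) carries the product topology of discrete topologies, and the shift $\sigma : S^{\mathbb{Z}} \to S^{\mathbb{Z}}$ is $\sigma(x)_i = x_{i+1}$. A cellular automaton on $S^{\mathbb{Z}}$ is a continuous map $f : S^{\mathbb{Z}} \to S^{\mathbb{Z}}$ commuting with $\sigma$. $\mathrm{End}(S^{\mathbb{Z}})$ is the monoid of all cellular automata on $S^{\mathbb{Z}}$ under composition, with identity element the identity map. Monoids are countable and have an identity element; monoid homomorphisms preserve products and the identity element. For monoids $N, M$, write $N \leq M$ if there is an injective monoid homomorphism $N \to M$. $\mathrm{sub}_m(M)$ denotes the class of isomorphism classes of submonoids of $M$ (submonoids contain the identity element of $M$). The direct product $M \times N$ has componentwise multiplication. *)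

theory Defs
  imports "HOL-Library.Cardinality" "HOL-Analysis.Function_Topology" "HOL-Algebra.Group"
begin

text \<open>The alphabet is an arbitrary type of class \<open>finite\<close>, so \<^typ>\<open>int \<Rightarrow> 'a\<close> is the full shift.\<close>

definition full_shift_topology :: "(int \<Rightarrow> 'a) topology" where
  "full_shift_topology = product_topology (\<lambda>_. discrete_topology UNIV) UNIV"

definition shift :: "(int \<Rightarrow> 'a) \<Rightarrow> (int \<Rightarrow> 'a)" where
  "shift x = (\<lambda>i. x (i + 1))"

definition cellular_automaton :: "((int \<Rightarrow> 'a::finite) \<Rightarrow> (int \<Rightarrow> 'a)) \<Rightarrow> bool" where
  "cellular_automaton f \<longleftrightarrow>
     continuous_map full_shift_topology full_shift_topology f \<and> f \<circ> shift = shift \<circ> f"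

definition End_full_shift :: "((int \<Rightarrow> 'a::finite) \<Rightarrow> (int \<Rightarrow> 'a)) monoid" where
  "End_full_shift = \<lparr>carrier = {f. cellular_automaton f}, mult = (\<circ>), one = id\<rparr>"

lemma monoid_End_full_shift: "monoid End_full_shift"
proof (rule monoidI)
  fix f g :: "(int \<Rightarrow> 'a::finite) \<Rightarrow> (int \<Rightarrow> 'a)"
  assume "f \<in> carrier End_full_shift" and "g \<in> carrier End_full_shift"
  then show "f \<otimes>\<^bsub>End_full_shift\<^esub> g \<in> carrier End_full_shift"
    by (auto simp: End_full_shift_def cellular_automaton_def intro: continuous_map_compose)
      (metis comp_assoc)
qed (auto simp: End_full_shift_def cellular_automaton_def id_def)

text \<open>Preservation of the identity is a separate conjunct, because \<^const>\<open>hom\<close> only requires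
  preservation of the carrier and of products.\<close>

definition embeds_in :: "('b, 'x) monoid_scheme \<Rightarrow> ('c, 'y) monoid_scheme \<Rightarrow> bool"
    (infix "\<le>\<^sub>m" 50) where
  "N \<le>\<^sub>m M \<longleftrightarrow>
     (\<exists>h \<in> hom N M. h \<one>\<^bsub>N\<^esub> = \<one>\<^bsub>M\<^esub> \<and> inj_on h (carrier N))"

end

theory Submission
  imports Defs
begin

text \<open>
  A pair of automata \<open>(f, g)\<close> acts on the full shift over \<open>'a \<times> 'a\<close>, with \<open>f\<close> on the first
  and \<open>g\<close> on the second coordinate of each symbol; this embeds the product
  \<open>End \<times> End\<close> (\<open>DirProd_End_embeds\<close>). What remains is to return to the alphabet \<open>'a\<close>. In fact
  the endomorphism monoid over any finite alphabet \<open>'b\<close> embeds into the one over any alphabet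
  with at least two symbols (\<open>End_embeds_in_End\<close>).

  Symbols of \<open>'b\<close> cannot simply be coded by words over \<open>'a\<close>, because a configuration over \<open>'a\<close>
  need not be a concatenation of code words, and the image of the identity has to be the identity
  everywhere. The remedy is the conveyor belt. Code pairs of symbols of \<open>'b\<close> by words of one length
  \<open>L\<close> such that two distinct occurrences of code words never overlap
  (\<open>nonoverlapping_code_exists\<close>). In an arbitrary configuration the occurrences, called blocks,
  then form runs of adjacent blocks, separated by other material. The first components
  along a run are a track read from left to right, the second components a track
  read from right to left, and at an end of a run each track continues into the other. A finite
  run is thus a cycle, a one-sided infinite run is one bi-infinite line, and a two-sided infinite
  run is two lines. In each case the symbols seen from a position on the belt are a configuration
  over \<open>'b\<close>, periodic in the case of a cycle. An automaton \<open>f\<close> over \<open>'b\<close> acts by applying itself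
  along all belts, and it leaves all other cells alone.

  This action moves no block, so it maps belts to belts, and what is read along a belt after the
  action of \<open>f\<close> is the image under \<open>f\<close> of what was read before (\<open>belt_belt_action\<close>). Hence
  composition and identity are preserved. The action is local because the parse into blocks and
  each step along a belt are local, and it is faithful because every configuration over
  \<open>'b\<close> occurs on the belt of a two-sided infinite run (\<open>belt_surj\<close>).
\<close>

section \<open>The topology of the full shift\<close>

lemma topspace_full_shift [simp]: "topspace full_shift_topology = UNIV"
  by (simp add: full_shift_topology_def)

lemma continuous_map_into_discrete_iff:
  "continuous_map X (discrete_topology UNIV) g \<longleftrightarrow>
     (\<forall>x\<in>topspace X. \<forall>\<^sub>F y in nhdsin X x. g y = g x)"
proof
  assume g: "continuous_map X (discrete_topology UNIV) g"
  show "\<forall>x\<in>topspace X. \<forall>\<^sub>F y in nhdsin X x. g y = g x"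
  proof
    fix x assume x: "x \<in> topspace X"
    have "openin X {y \<in> topspace X. g y \<in> {g x}}"
      using openin_continuous_map_preimage[OF g, of "{g x}"] by simp
    then show "\<forall>\<^sub>F y in nhdsin X x. g y = g x"
      using x by (auto simp: eventually_nhdsin)
  qed
next
  assume *: "\<forall>x\<in>topspace X. \<forall>\<^sub>F y in nhdsin X x. g y = g x"
  have "openin X {y \<in> topspace X. g y \<in> U}" for U
  proof (subst openin_subopen, intro ballI)
    fix x assume x: "x \<in> {y \<in> topspace X. g y \<in> U}"
    then obtain S where "openin X S" "x \<in> S" "\<forall>y\<in>S. g y = g x"
      using * unfolding eventually_nhdsin by blast
    moreover have "g y \<in> U" if "y \<in> S" for y
      using that x calculation(3) by (metis mem_Collect_eq)
    ultimately show "\<exists>T. openin X T \<and> x \<in> T \<and> T \<subseteq> {y \<in> topspace X. g y \<in> U}"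
      using openin_subset by (intro exI[of _ S]) blast
  qed
  then show "continuous_map X (discrete_topology UNIV) g"
    by (simp add: continuous_map_def)
qed

text \<open>Continuity into the full shift says that each output cell is locally constant. In this form
  it can be checked with the calculus of eventually true statements, without radii or explicit
  windows.\<close>
lemma continuous_map_into_full_shift_iff:
  "continuous_map X full_shift_topology f \<longleftrightarrow>
     (\<forall>x\<in>topspace X. \<forall>i. \<forall>\<^sub>F y in nhdsin X x. f y i = f x i)"
  unfolding full_shift_topology_def continuous_map_componentwise_UNIV
    continuous_map_into_discrete_iff by blast

lemma eventually_coordinate_eq:
  fixes x :: "int \<Rightarrow> 'a"
  shows "\<forall>\<^sub>F y in nhdsin full_shift_topology x. y i = x i"
proof -
  have "continuous_map full_shift_topology full_shift_topology (\<lambda>x :: int \<Rightarrow> 'a. x)"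
    by simp
  then show ?thesis
    unfolding continuous_map_into_full_shift_iff by simp
qed

section \<open>Cellular automata commute with all translations\<close>

lemma shift_apply: "shift x i = x (i + 1)"
  by (simp add: shift_def)

lemma cellular_automaton_shift:
  assumes "cellular_automaton f"
  shows "f (shift x) = shift (f x)"
  using assms unfolding cellular_automaton_def by (metis comp_apply)

lemma cellular_automaton_translation:
  assumes f: "cellular_automaton f"
  shows "f (\<lambda>i. x (i + k)) = (\<lambda>i. f x (i + k))"
proof (induction k rule: int_induct[of _ 0])
  case base
  then show ?case by simp
next
  case (step1 k)
  have "f (\<lambda>i. x (i + (k + 1))) = f (shift (\<lambda>i. x (i + k)))"
    by (simp add: shift_def add_ac)
  also have "\<dots> = shift (\<lambda>i. f x (i + k))"
    by (simp only: cellular_automaton_shift[OF f] step1.IH)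
  also have "\<dots> = (\<lambda>i. f x (i + (k + 1)))"
    by (simp add: shift_def add_ac)
  finally show ?case .
next
  case (step2 k)
  have "shift (f (\<lambda>i. x (i + (k - 1)))) = f (\<lambda>i. x (i + k))"
    unfolding cellular_automaton_shift[OF f, symmetric] by (simp add: shift_def)
  then have "f (\<lambda>i. x (i + (k - 1))) (j + 1) = f x (j + k)" for j
    unfolding step2.IH by (auto simp: shift_def fun_eq_iff)
  from this[of "_ - 1"] show ?case
    by (auto simp: fun_eq_iff algebra_simps)
qed

section \<open>Integer iterates of a bijection\<close>

definition int_iterate :: "('s \<Rightarrow> 's) \<Rightarrow> int \<Rightarrow> 's \<Rightarrow> 's" where
  "int_iterate h k = (if 0 \<le> k then h ^^ nat k else (inv_into UNIV h) ^^ nat (- k))"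

lemma int_iterate_0 [simp]: "int_iterate h 0 s = s"
  by (simp add: int_iterate_def)

lemma int_iterate_add1:
  assumes "bij h"
  shows "int_iterate h (k + 1) s = h (int_iterate h k s)"
proof (cases "0 \<le> k")
  case True
  then show ?thesis by (simp add: int_iterate_def nat_add_distrib)
next
  case False
  define n where "n = nat (- k - 1)"
  have k: "k = - int n - 1" using False by (simp add: n_def)
  show ?thesis
  proof (cases n)
    case 0
    then show ?thesis
      using k assms by (simp add: int_iterate_def bij_is_surj surj_f_inv_f)
  next
    case (Suc m)
    have "nat (- k) = Suc n" "nat (- (k + 1)) = n" "\<not> 0 \<le> k" "\<not> 0 \<le> k + 1"
      using k Suc by auto
    then show ?thesis
      using assms by (simp add: int_iterate_def bij_is_surj surj_f_inv_f)
  qed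
qed

lemma int_iterate_diff1:
  assumes "bij h"
  shows "int_iterate h (k - 1) s = inv_into UNIV h (int_iterate h k s)"
  using int_iterate_add1[OF assms, of "k - 1" s] assms by (simp add: bij_is_inj)

lemma int_iterate_add:
  assumes "bij h"
  shows "int_iterate h (j + k) s = int_iterate h j (int_iterate h k s)"
proof (induction j rule: int_induct[of _ 0])
  case base
  then show ?case by simp
next
  case (step1 j)
  have "int_iterate h (j + 1 + k) s = h (int_iterate h (j + k) s)"
    using int_iterate_add1[OF assms, of "j + k" s] by (simp add: add_ac)
  then show ?case by (simp add: step1.IH int_iterate_add1[OF assms])
next
  case (step2 j)
  have "int_iterate h (j - 1 + k) s = inv_into UNIV h (int_iterate h (j + k) s)"
    using int_iterate_diff1[OF assms, of "j + k" s] by (simp add: algebra_simps)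
  then show ?case by (simp add: step2.IH int_iterate_diff1[OF assms])
qed

lemma int_iterate_invariant:
  assumes "bij h" "P s" "\<And>s. P s \<Longrightarrow> P (h s)" "\<And>s. P s \<Longrightarrow> P (inv_into UNIV h s)"
  shows "P (int_iterate h k s)"
  by (induction k rule: int_induct[of _ 0])
    (simp_all add: assms int_iterate_add1 int_iterate_diff1)

text \<open>Cancelling \<open>h\<close> carries the relation over to negative iterates.\<close>
lemma int_iterate_semiconjugate:
  assumes "bij g" "bij h" "\<And>s. T (g s) = h (T s)"
  shows "T (int_iterate g k s) = int_iterate h k (T s)"
proof (induction k rule: int_induct[of _ 0])
  case (step2 k)
  have "T (int_iterate g k s) = h (T (inv_into UNIV g (int_iterate g k s)))"
    using assms(1) by (simp add: assms(3)[symmetric] bij_is_surj surj_f_inv_f)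
  then have "T (inv_into UNIV g (int_iterate g k s)) = inv_into UNIV h (T (int_iterate g k s))"
    using assms(2) by (simp add: bij_is_inj)
  then show ?case by (simp add: step2.IH int_iterate_diff1 assms)
qed (simp_all add: assms int_iterate_add1)

section \<open>Conveyor belts\<close>

text \<open>The second assumption contains both that distinct occurrences of code words are disjoint and,
  for \<open>p = q\<close>, that the coding is injective.\<close>
locale nonoverlapping_code =
  fixes code :: "'b::finite \<times> 'b \<Rightarrow> int \<Rightarrow> 'a::finite" and L :: int
  assumes L_pos: "0 < L"
    and nonoverlapping:
      "\<lbrakk>\<forall>t\<in>{0..<L}. x (p + t) = code v t; \<forall>t\<in>{0..<L}. x (q + t) = code w t; \<bar>p - q\<bar> < L\<rbrakk>
        \<Longrightarrow> p = q \<and> v = w"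
begin

definition occurs :: "(int \<Rightarrow> 'a) \<Rightarrow> int \<Rightarrow> 'b \<times> 'b \<Rightarrow> bool" where
  "occurs x p w \<longleftrightarrow> (\<forall>t\<in>{0..<L}. x (p + t) = code w t)"

definition block :: "(int \<Rightarrow> 'a) \<Rightarrow> int \<Rightarrow> bool" where
  "block x p \<longleftrightarrow> (\<exists>w. occurs x p w)"

definition content :: "(int \<Rightarrow> 'a) \<Rightarrow> int \<times> bool \<Rightarrow> 'b" where
  "content x s = (if snd s then fst else snd) (THE w. occurs x (fst s) w)"

definition link :: "(int \<Rightarrow> 'a) \<Rightarrow> int \<Rightarrow> bool" where
  "link x p \<longleftrightarrow> block x p \<and> block x (p + L)"

text \<open>A belt position is a pair of a cell \<open>p\<close> and a direction, where \<open>True\<close> stands for the track that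
  moves right. The step turns around whenever there is no adjacent block in the direction of
  travel. Positions that are not at a block never move and just swap their direction, which
  makes the step a bijection of the whole type, so that no case distinction on the shape of a run is
  ever required.\<close>
fun belt_next :: "(int \<Rightarrow> 'a) \<Rightarrow> int \<times> bool \<Rightarrow> int \<times> bool" where
  "belt_next x (p, True) = (if link x p then (p + L, True) else (p, False))"
| "belt_next x (p, False) = (if link x (p - L) then (p - L, False) else (p, True))"

fun belt_prev :: "(int \<Rightarrow> 'a) \<Rightarrow> int \<times> bool \<Rightarrow> int \<times> bool" where
  "belt_prev x (p, True) = (if link x (p - L) then (p - L, True) else (p, False))"
| "belt_prev x (p, False) = (if link x p then (p + L, False) else (p, True))"

definition belt :: "(int \<Rightarrow> 'a) \<Rightarrow> int \<times> bool \<Rightarrow> int \<Rightarrow> 'b" where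
  "belt x s k = content x (int_iterate (belt_next x) k s)"

definition rewritten :: "((int \<Rightarrow> 'b) \<Rightarrow> int \<Rightarrow> 'b) \<Rightarrow> (int \<Rightarrow> 'a) \<Rightarrow> int \<Rightarrow> 'b \<times> 'b" where
  "rewritten f x p = (f (belt x (p, True)) 0, f (belt x (p, False)) 0)"

definition belt_action :: "((int \<Rightarrow> 'b) \<Rightarrow> int \<Rightarrow> 'b) \<Rightarrow> (int \<Rightarrow> 'a) \<Rightarrow> int \<Rightarrow> 'a" where
  "belt_action f x i =
     (if \<exists>p. block x p \<and> i \<in> {p..<p + L}
      then let p = (THE p. block x p \<and> i \<in> {p..<p + L}) in code (rewritten f x p) (i - p)
      else x i)"

lemma occurs_unique:
  "\<lbrakk>occurs x p v; occurs x q w; \<bar>p - q\<bar> < L\<rbrakk> \<Longrightarrow> p = q \<and> v = w"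
  unfolding occurs_def by (rule nonoverlapping)

lemma block_unique: "\<lbrakk>block x p; block x q; \<bar>p - q\<bar> < L\<rbrakk> \<Longrightarrow> p = q"
  unfolding block_def using occurs_unique by blast

lemma content_eq:
  assumes "occurs x p w"
  shows "content x (p, d) = (if d then fst w else snd w)"
proof -
  have "(THE w. occurs x p w) = w"
  proof (rule the_equality)
    show "v = w" if "occurs x p v" for v
      using occurs_unique[OF that assms] L_pos by simp
  qed (rule assms)
  then show ?thesis by (simp add: content_def)
qed

lemma belt_prev_next [simp]: "belt_prev x (belt_next x s) = s"
  by (cases "(x, s)" rule: belt_next.cases) auto

lemma belt_next_prev [simp]: "belt_next x (belt_prev x s) = s"
  by (cases "(x, s)" rule: belt_next.cases) auto

lemma bij_belt_next: "bij (belt_next x)"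
  by (rule o_bij[of "belt_prev x"]) (auto simp: fun_eq_iff)

lemma inv_belt_next: "inv_into UNIV (belt_next x) = belt_prev x"
  by (rule inv_equality) auto

lemma belt_0 [simp]: "belt x s 0 = content x s"
  by (simp add: belt_def)

text \<open>Moving the observer along the belt translates what is read. Together with translation
  invariance of automata, this makes the local rewriting of single blocks consistent along a
  belt.\<close>
lemma belt_iterate: "belt x (int_iterate (belt_next x) k s) = (\<lambda>j. belt x s (j + k))"
  by (simp add: belt_def fun_eq_iff int_iterate_add[OF bij_belt_next])

lemma block_belt_next: "block x (fst s) \<Longrightarrow> block x (fst (belt_next x s))"
  by (cases "(x, s)" rule: belt_next.cases) (auto simp: link_def)

lemma block_belt_prev: "block x (fst s) \<Longrightarrow> block x (fst (belt_prev x s))"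
  by (cases "(x, s)" rule: belt_prev.cases) (auto simp: link_def)

lemma block_iterate:
  "block x (fst s) \<Longrightarrow> block x (fst (int_iterate (belt_next x) k s))"
  by (rule int_iterate_invariant[OF bij_belt_next])
    (simp_all add: block_belt_next inv_belt_next block_belt_prev)

lemma belt_action_inside:
  assumes "block x p" "i \<in> {p..<p + L}"
  shows "belt_action f x i = code (rewritten f x p) (i - p)"
proof -
  have "(THE p. block x p \<and> i \<in> {p..<p + L}) = p"
    using assms block_unique[of x _ p] by (intro the_equality) auto
  then show ?thesis using assms by (auto simp: belt_action_def)
qed

lemma belt_action_outside:
  assumes "\<And>p. \<lbrakk>block x p; i \<in> {p..<p + L}\<rbrakk> \<Longrightarrow> False"
  shows "belt_action f x i = x i"
  using assms by (auto simp: belt_action_def)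

lemma occurs_belt_action:
  assumes "block x p"
  shows "occurs (belt_action f x) p (rewritten f x p)"
  using belt_action_inside[OF assms, of _ f] by (simp add: occurs_def)

text \<open>Rewritten blocks remain blocks. A block that arises anew would have to use a rewritten cell, so
  it would overlap an old block, which still is a block; but blocks do not overlap.\<close>
lemma block_belt_action [simp]: "block (belt_action f x) p \<longleftrightarrow> block x p"
proof
  assume "block x p"
  then show "block (belt_action f x) p"
    using occurs_belt_action block_def by blast
next
  assume y: "block (belt_action f x) p"
  show "block x p"
  proof (cases "\<exists>q. block x q \<and> \<bar>p - q\<bar> < L")
    case True
    then obtain q where q: "block x q" "\<bar>p - q\<bar> < L" by blast
    then have "block (belt_action f x) q" using occurs_belt_action block_def by blast
    with y q show ?thesis using block_unique by blast
  next
    case False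
    have "belt_action f x (p + t) = x (p + t)" if "t \<in> {0..<L}" for t
      by (rule belt_action_outside) (use that False in force)
    then show ?thesis using y by (auto simp: block_def occurs_def)
  qed
qed

lemma belt_next_belt_action [simp]: "belt_next (belt_action f x) = belt_next x"
proof
  fix s show "belt_next (belt_action f x) s = belt_next x s"
    by (cases "(x, s)" rule: belt_next.cases) (simp_all add: link_def)
qed

lemma content_belt_action:
  assumes "block x (fst s)"
  shows "content (belt_action f x) s = f (belt x s) 0"
  using content_eq[OF occurs_belt_action[OF assms], of f "snd s"]
  by (cases s; cases "snd s") (auto simp: rewritten_def)

text \<open>The heart of the construction. The belts before and after the action visit the same positions,
  and at the \<open>k\<close>-th of them the new symbol is \<open>f\<close> of the belt read from there, evaluated at \<open>0\<close>;
  by translation invariance this is \<open>f\<close> of the original belt, evaluated at \<open>k\<close>.\<close>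
lemma belt_belt_action:
  assumes "cellular_automaton f" "block x (fst s)"
  shows "belt (belt_action f x) s = f (belt x s)"
proof
  fix k
  let ?s = "int_iterate (belt_next x) k s"
  have "belt (belt_action f x) s k = f (belt x ?s) 0"
    using assms(2) by (simp add: belt_def content_belt_action block_iterate)
  also have "\<dots> = f (belt x s) k"
    by (simp add: belt_iterate cellular_automaton_translation[OF assms(1)])
  finally show "belt (belt_action f x) s k = f (belt x s) k" .
qed

lemma belt_action_comp:
  assumes "cellular_automaton g"
  shows "belt_action (f \<circ> g) = belt_action f \<circ> belt_action g"
proof (intro ext)
  fix x i
  show "belt_action (f \<circ> g) x i = (belt_action f \<circ> belt_action g) x i"
  proof (cases "\<exists>p. block x p \<and> i \<in> {p..<p + L}")
    case True
    then obtain p where p: "block x p" "i \<in> {p..<p + L}" by blast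
    then have "rewritten f (belt_action g x) p = rewritten (f \<circ> g) x p"
      using assms by (simp add: rewritten_def belt_belt_action)
    then show ?thesis
      using p by (simp add: belt_action_inside[of _ p])
  next
    case False
    then have "belt_action h x i = x i" "belt_action h (belt_action g x) i = belt_action g x i" for h
      by (auto intro!: belt_action_outside)
    then show ?thesis by simp
  qed
qed

lemma belt_action_id: "belt_action id = id"
proof (intro ext)
  fix x i
  show "belt_action id x i = id x i"
  proof (cases "\<exists>p. block x p \<and> i \<in> {p..<p + L}")
    case True
    then obtain p w where p: "block x p" "i \<in> {p..<p + L}" "occurs x p w"
      unfolding block_def by blast
    then have "rewritten id x p = w" by (simp add: rewritten_def content_eq)
    moreover have "x (p + (i - p)) = code w (i - p)"
      using p unfolding occurs_def by (intro bspec[where x = "i - p"]) auto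
    ultimately show ?thesis using p by (simp add: belt_action_inside)
  next
    case False
    then show ?thesis by (auto intro!: belt_action_outside)
  qed
qed

lemma occurs_shift: "occurs (shift x) p w \<longleftrightarrow> occurs x (p + 1) w"
  by (simp add: occurs_def shift_def add_ac)

lemma block_shift: "block (shift x) p \<longleftrightarrow> block x (p + 1)"
  by (simp add: block_def occurs_shift)

lemma belt_next_shift:
  "map_prod (\<lambda>p. p + 1) id (belt_next (shift x) s) = belt_next x (map_prod (\<lambda>p. p + 1) id s)"
  by (cases "(x, s)" rule: belt_next.cases) (auto simp: link_def block_shift algebra_simps)

lemma belt_shift: "belt (shift x) s = belt x (map_prod (\<lambda>p. p + 1) id s)"
proof -
  have "content (shift x) s = content x (map_prod (\<lambda>p. p + 1) id s)" for s
    by (simp add: content_def occurs_shift)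
  moreover have "map_prod (\<lambda>p. p + 1) id (int_iterate (belt_next (shift x)) k s) =
      int_iterate (belt_next x) k (map_prod (\<lambda>p. p + 1) id s)" for k
    by (rule int_iterate_semiconjugate) (rule bij_belt_next bij_belt_next belt_next_shift)+
  ultimately show ?thesis
    by (simp add: belt_def fun_eq_iff)
qed

lemma belt_action_shift: "belt_action f (shift x) = shift (belt_action f x)"
proof
  fix i
  show "belt_action f (shift x) i = shift (belt_action f x) i"
  proof (cases "\<exists>p. block (shift x) p \<and> i \<in> {p..<p + L}")
    case True
    then obtain p where p: "block (shift x) p" "i \<in> {p..<p + L}" by blast
    then have "belt_action f x (i + 1) = code (rewritten f x (p + 1)) (i - p)"
      using belt_action_inside[of x "p + 1" "i + 1" f] by (simp add: block_shift)
    moreover have "rewritten f (shift x) p = rewritten f x (p + 1)"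
      by (simp add: rewritten_def belt_shift)
    ultimately show ?thesis using p by (simp add: shift_def belt_action_inside)
  next
    case False
    have "belt_action f x (i + 1) = x (i + 1)"
    proof (rule belt_action_outside)
      fix p assume "block x p" "i + 1 \<in> {p..<p + L}"
      then have "block (shift x) (p - 1) \<and> i \<in> {p - 1..<p - 1 + L}"
        by (simp add: block_shift)
      with False show False by blast
    qed
    moreover have "belt_action f (shift x) i = shift x i"
      using False by (auto intro!: belt_action_outside)
    ultimately show ?thesis by (simp add: shift_def)
  qed
qed

abbreviation near :: "(int \<Rightarrow> 'a) \<Rightarrow> (int \<Rightarrow> 'a) filter" where
  "near x \<equiv> nhdsin full_shift_topology x"

text \<open>Whether a word occurs at a given cell depends on \<open>L\<close> cells only. The other ingredients of the
  action are composed of finitely many such tests, except for \<open>f\<close> itself, which reads a whole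
  belt but is continuous; so all of them are locally constant in the configuration.\<close>
lemma eventually_occurs_eq: "\<forall>\<^sub>F y in near x. occurs y p = occurs x p"
proof -
  have "\<forall>\<^sub>F y in near x. \<forall>t\<in>{0..<L}. y (p + t) = x (p + t)"
    by (intro eventually_ball_finite ballI eventually_coordinate_eq) simp
  then show ?thesis
    by eventually_elim (auto simp: occurs_def fun_eq_iff)
qed

lemma eventually_block_eq: "\<forall>\<^sub>F y in near x. block y p = block x p"
  using eventually_occurs_eq[of p x] by eventually_elim (simp add: block_def)

lemma eventually_content_eq: "\<forall>\<^sub>F y in near x. content y s = content x s"
  using eventually_occurs_eq[of "fst s" x] by eventually_elim (simp add: content_def)

lemma eventually_link_eq: "\<forall>\<^sub>F y in near x. link y p = link x p"
  using eventually_block_eq[of p x] eventually_block_eq[of "p + L" x]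
  by eventually_elim (simp add: link_def)

lemma eventually_belt_next_eq: "\<forall>\<^sub>F y in near x. belt_next y s = belt_next x s"
  using eventually_link_eq[of "fst s" x] eventually_link_eq[of "fst s - L" x]
  by eventually_elim (cases "(x, s)" rule: belt_next.cases; simp)

lemma eventually_belt_prev_eq: "\<forall>\<^sub>F y in near x. belt_prev y s = belt_prev x s"
  using eventually_link_eq[of "fst s" x] eventually_link_eq[of "fst s - L" x]
  by eventually_elim (cases "(x, s)" rule: belt_prev.cases; simp)

lemma eventually_iterate_eq:
  "\<forall>\<^sub>F y in near x. int_iterate (belt_next y) k s = int_iterate (belt_next x) k s"
proof (induction k rule: int_induct[of _ 0])
  case (step1 k)
  from step1.IH show ?case
    using eventually_belt_next_eq[of "int_iterate (belt_next x) k s" x]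
    by eventually_elim (simp add: int_iterate_add1 bij_belt_next)
next
  case (step2 k)
  from step2.IH show ?case
    using eventually_belt_prev_eq[of "int_iterate (belt_next x) k s" x]
    by eventually_elim (simp add: int_iterate_diff1 bij_belt_next inv_belt_next)
qed simp

lemma continuous_belt:
  "continuous_map full_shift_topology full_shift_topology (\<lambda>x. belt x s)"
  unfolding continuous_map_into_full_shift_iff
proof (intro ballI allI)
  fix x k
  show "\<forall>\<^sub>F y in near x. belt y s k = belt x s k"
    using eventually_iterate_eq[of k s x]
      eventually_content_eq[of "int_iterate (belt_next x) k s" x]
    by eventually_elim (simp add: belt_def)
qed

lemma eventually_rewritten_eq:
  assumes "cellular_automaton f"
  shows "\<forall>\<^sub>F y in near x. rewritten f y p = rewritten f x p"
proof -
  have "continuous_map full_shift_topology full_shift_topology f"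
    using assms by (simp add: cellular_automaton_def)
  then have "continuous_map full_shift_topology full_shift_topology (f \<circ> (\<lambda>x. belt x s))" for s
    using continuous_belt continuous_map_compose by blast
  then have "\<forall>\<^sub>F y in near x. f (belt y s) 0 = f (belt x s) 0" for s
    by (simp add: continuous_map_into_full_shift_iff)
  from this[of "(p, True)"] this[of "(p, False)"] show ?thesis
    by eventually_elim (simp add: rewritten_def)
qed

lemma cellular_automaton_belt_action:
  assumes "cellular_automaton f"
  shows "cellular_automaton (belt_action f)"
  unfolding cellular_automaton_def
proof
  show "continuous_map full_shift_topology full_shift_topology (belt_action f)"
    unfolding continuous_map_into_full_shift_iff
  proof (intro ballI allI)
    fix x i
    show "\<forall>\<^sub>F y in near x. belt_action f y i = belt_action f x i"
    proof (cases "\<exists>p. block x p \<and> i \<in> {p..<p + L}")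
      case True
      then obtain p where p: "block x p" "i \<in> {p..<p + L}" by blast
      show ?thesis
        using eventually_block_eq[of p x] eventually_rewritten_eq[OF assms, of p x]
        by eventually_elim (use p in \<open>simp add: belt_action_inside[of _ p]\<close>)
    next
      case False
      have "\<forall>\<^sub>F y in near x. \<forall>p\<in>{i - L<..i}. block y p = block x p"
        by (intro eventually_ball_finite ballI eventually_block_eq) simp
      then show ?thesis
        using eventually_coordinate_eq[of i x]
      proof eventually_elim
        case (elim y)
        have "belt_action f y i = y i"
          by (rule belt_action_outside) (use elim False in force)
        moreover have "belt_action f x i = x i"
          using False by (auto intro!: belt_action_outside)
        ultimately show ?case using elim by simp
      qed
    qed
  qed
  show "belt_action f \<circ> shift = shift \<circ> belt_action f"
    by (simp add: fun_eq_iff belt_action_shift)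
qed

text \<open>Fill the whole line with adjacent blocks that carry \<open>z\<close> on the track that moves right; what the
  other track carries is arbitrary.\<close>
lemma belt_surj: "\<exists>x. block x 0 \<and> belt x (0, True) = z"
proof -
  define x where "x i = code (z (i div L), z (i div L)) (i mod L)" for i
  have occ: "occurs x (k * L) (z k, z k)" for k
    using L_pos by (auto simp: occurs_def x_def div_add1_eq)
  then have "block x (k * L)" for k
    unfolding block_def by blast
  from this this[of "_ + 1"] have link: "link x (k * L)" for k
    unfolding link_def distrib_right by simp
  have "int_iterate (belt_next x) k (0, True) = (k * L, True)" for k
  proof (induction k rule: int_induct[of _ 0])
    case (step1 k)
    then show ?case
      using link[of k] by (simp add: int_iterate_add1 bij_belt_next distrib_right)
  next
    case (step2 k)
    then show ?case
      using link[of "k - 1"]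
      by (simp add: int_iterate_diff1 bij_belt_next inv_belt_next left_diff_distrib)
  qed simp
  then have "belt x (0, True) = z"
    by (simp add: belt_def content_eq[OF occ] fun_eq_iff)
  moreover have "block x 0" using link[of 0] by (simp add: link_def)
  ultimately show ?thesis by blast
qed

text \<open>An automaton is determined by the symbols \<open>f z 0\<close>, and these can be recovered from the action
  on a configuration in which \<open>z\<close> is read along a belt.\<close>
lemma inj_on_belt_action: "inj_on belt_action {f. cellular_automaton f}"
proof (intro inj_onI ext)
  fix f g :: "(int \<Rightarrow> 'b) \<Rightarrow> int \<Rightarrow> 'b" and z :: "int \<Rightarrow> 'b" and k
  assume fg: "f \<in> {f. cellular_automaton f}" "g \<in> {f. cellular_automaton f}"
    and eq: "belt_action f = belt_action g"
  define z' where "z' = (\<lambda>i. z (i + k))"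
  obtain x where "block x 0" "belt x (0, True) = z'" using belt_surj by blast
  then have "f z' 0 = g z' 0"
    using content_belt_action[of x "(0, True)" f] content_belt_action[of x "(0, True)" g] eq
    by simp
  then show "f z k = g z k"
    using fg by (simp add: z'_def cellular_automaton_translation)
qed

lemma End_embeds:
  "(End_full_shift :: ((int \<Rightarrow> 'b) \<Rightarrow> int \<Rightarrow> 'b) monoid) \<le>\<^sub>m
   (End_full_shift :: ((int \<Rightarrow> 'a) \<Rightarrow> int \<Rightarrow> 'a) monoid)"
  unfolding embeds_in_def
proof (intro bexI conjI)
  show "belt_action \<in> hom End_full_shift End_full_shift"
    by (auto simp: hom_def End_full_shift_def cellular_automaton_belt_action belt_action_comp)
qed (use belt_action_id inj_on_belt_action in \<open>auto simp: End_full_shift_def\<close>)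

end

section \<open>Embedding the endomorphisms of one full shift into another\<close>

text \<open>With \<open>n\<close> at least the number of symbols to be coded and \<open>e\<close> a numbering of them, the code word
  of \<open>w\<close> is
  \<open>a\<close> repeated \<open>n + 1\<close> times, then \<open>b\<close>, then \<open>n\<close> letters of which only the one at index \<open>e w\<close> is
  \<open>b\<close>, then a final \<open>b\<close>. If a second code word starts strictly inside an occurrence of a first one,
  its initial run of \<open>n + 1\<close> letters \<open>a\<close> covers one of the two letters \<open>b\<close> that delimit the middle
  part, because these two are only \<open>n + 1\<close> cells apart and the second of them ends the word.\<close>
lemma nonoverlapping_code_exists:
  assumes "CARD('a::finite) \<ge> 2"
  shows "\<exists>(code :: 'b::finite \<times> 'b \<Rightarrow> int \<Rightarrow> 'a) L. nonoverlapping_code code L"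
proof -
  obtain a b :: 'a where ab: "a \<noteq> b"
    using assms card_le_Suc0_iff_eq[of "UNIV :: 'a set"] by fastforce
  obtain e :: "'b \<times> 'b \<Rightarrow> nat" and n where "e ` UNIV = {i. i < n}" and inj: "inj e"
    using finite_imp_inj_to_nat_seg[of "UNIV :: ('b \<times> 'b) set"] by auto
  then have bound: "e w < n" for w by blast
  define N where "N = int n"
  define L where "L = 2 * N + 3"
  define code where "code w t = (if t \<in> {N + 1, N + 2 + int (e w), 2 * N + 2} then b else a)" for w t
  have lt: "q \<le> p"
    if v: "\<forall>t\<in>{0..<L}. x (p + t) = code v t" and w: "\<forall>t\<in>{0..<L}. x (q + t) = code w t"
      and "q < p + L" for x p q v w
  proof (rule ccontr)
    assume "\<not> q \<le> p"
    \<comment> \<open>The first delimiter of the word at \<open>p\<close> that is not to the left of \<open>q\<close>.\<close>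
    define i where "i = (if q \<le> p + N + 1 then p + N + 1 else p + 2 * N + 2)"
    have "x i = b"
      using v[rule_format, of "i - p"] by (auto simp: i_def code_def L_def N_def)
    moreover have "x i = a"
      using w[rule_format, of "i - q"] \<open>\<not> q \<le> p\<close> \<open>q < p + L\<close>
      by (auto simp: i_def code_def L_def N_def split: if_splits)
    ultimately show False using ab by simp
  qed
  have "nonoverlapping_code code L"
  proof
    show "0 < L" by (simp add: L_def N_def)
  next
    fix x p v q w
    assume v: "\<forall>t\<in>{0..<L}. x (p + t) = code v t" and w: "\<forall>t\<in>{0..<L}. x (q + t) = code w t"
      and pq: "\<bar>p - q\<bar> < L"
    have "p = q" using lt[OF v w] lt[OF w v] pq by linarith
    moreover have "e v = e w"
    proof -
      let ?t = "N + 2 + int (e v)"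
      have t: "?t \<in> {0..<L}" using bound[of v] by (simp add: L_def N_def)
      then have "code w ?t = code v ?t"
        using v[rule_format, OF t] w[rule_format, OF t] \<open>p = q\<close> by simp
      then show ?thesis using ab bound[of v] by (auto simp: code_def N_def split: if_splits)
    qed
    ultimately show "p = q \<and> v = w" using inj by (simp add: inj_eq)
  qed
  then show ?thesis by blast
qed

text \<open>A larger alphabet on the left is paid for with longer blocks.\<close>
theorem End_embeds_in_End:
  assumes "CARD('a::finite) \<ge> 2"
  shows "(End_full_shift :: ((int \<Rightarrow> 'b::finite) \<Rightarrow> int \<Rightarrow> 'b) monoid) \<le>\<^sub>m
         (End_full_shift :: ((int \<Rightarrow> 'a) \<Rightarrow> int \<Rightarrow> 'a) monoid)"
proof -
  obtain code :: "'b \<times> 'b \<Rightarrow> int \<Rightarrow> 'a" and L where "nonoverlapping_code code L"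
    using nonoverlapping_code_exists[OF assms] by blast
  then show ?thesis by (rule nonoverlapping_code.End_embeds)
qed

section \<open>Direct products\<close>

lemma embeds_in_trans [trans]: "\<lbrakk>K \<le>\<^sub>m M; M \<le>\<^sub>m N\<rbrakk> \<Longrightarrow> K \<le>\<^sub>m N"
  unfolding embeds_in_def
proof (elim bexE conjE)
  fix g h
  assume g: "g \<in> hom K M" "g \<one>\<^bsub>K\<^esub> = \<one>\<^bsub>M\<^esub>" "inj_on g (carrier K)"
    and h: "h \<in> hom M N" "h \<one>\<^bsub>M\<^esub> = \<one>\<^bsub>N\<^esub>" "inj_on h (carrier M)"
  have "g ` carrier K \<subseteq> carrier M" using g(1) by (auto simp: hom_def)
  then have "inj_on (h \<circ> g) (carrier K)"
    using g(3) h(3) by (intro comp_inj_on) (auto intro: inj_on_subset)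
  moreover have "h \<circ> g \<in> hom K N"
    using g(1) h(1) by (intro homI) (simp_all add: hom_mult hom_in_carrier)
  ultimately show "\<exists>h\<in>hom K N. h \<one>\<^bsub>K\<^esub> = \<one>\<^bsub>N\<^esub> \<and> inj_on h (carrier K)"
    using g(2) h(2) by (intro bexI[of _ "h \<circ> g"]) auto
qed

lemma embeds_in_DirProd:
  assumes "M \<le>\<^sub>m M'" "N \<le>\<^sub>m N'"
  shows "M \<times>\<times> N \<le>\<^sub>m M' \<times>\<times> N'"
proof -
  from assms obtain g h
    where g: "g \<in> hom M M'" "g \<one>\<^bsub>M\<^esub> = \<one>\<^bsub>M'\<^esub>" "inj_on g (carrier M)"
      and h: "h \<in> hom N N'" "h \<one>\<^bsub>N\<^esub> = \<one>\<^bsub>N'\<^esub>" "inj_on h (carrier N)"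
    unfolding embeds_in_def by blast
  have "map_prod g h \<in> hom (M \<times>\<times> N) (M' \<times>\<times> N')"
    using g(1) h(1) by (auto simp: hom_def DirProd_def)
  moreover have "inj_on (map_prod g h) (carrier (M \<times>\<times> N))"
    using g(3) h(3) by (auto simp: DirProd_def intro: map_prod_inj_on)
  ultimately show ?thesis
    unfolding embeds_in_def
    using g(2) h(2) by (intro bexI[of _ "map_prod g h"]) (auto simp: DirProd_def)
qed

definition track_product ::
  "((int \<Rightarrow> 'a) \<Rightarrow> int \<Rightarrow> 'a) \<times> ((int \<Rightarrow> 'b) \<Rightarrow> int \<Rightarrow> 'b) \<Rightarrow> (int \<Rightarrow> 'a \<times> 'b) \<Rightarrow> int \<Rightarrow> 'a \<times> 'b" where
  "track_product fg z i = (fst fg (fst \<circ> z) i, snd fg (snd \<circ> z) i)"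

lemma continuous_map_pointwise:
  "continuous_map full_shift_topology full_shift_topology (\<lambda>z. \<pi> \<circ> z)"
  unfolding continuous_map_into_full_shift_iff
proof (intro ballI allI)
  fix z i
  show "\<forall>\<^sub>F y in nhdsin full_shift_topology z. (\<pi> \<circ> y) i = (\<pi> \<circ> z) i"
    using eventually_coordinate_eq[of i z] by eventually_elim simp
qed

lemma cellular_automaton_track_product:
  fixes f :: "(int \<Rightarrow> 'a::finite) \<Rightarrow> int \<Rightarrow> 'a" and g :: "(int \<Rightarrow> 'b::finite) \<Rightarrow> int \<Rightarrow> 'b"
  assumes f: "cellular_automaton f" and g: "cellular_automaton g"
  shows "cellular_automaton (track_product (f, g))"
  unfolding cellular_automaton_def
proof
  have "continuous_map full_shift_topology full_shift_topology (f \<circ> (\<lambda>z :: int \<Rightarrow> 'a \<times> 'b. fst \<circ> z))"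
    "continuous_map full_shift_topology full_shift_topology (g \<circ> (\<lambda>z :: int \<Rightarrow> 'a \<times> 'b. snd \<circ> z))"
    using f g unfolding cellular_automaton_def
    by (auto intro: continuous_map_compose[OF continuous_map_pointwise])
  then have ev: "\<forall>\<^sub>F y in nhdsin full_shift_topology z. f (fst \<circ> y) i = f (fst \<circ> z) i"
    "\<forall>\<^sub>F y in nhdsin full_shift_topology z. g (snd \<circ> y) i = g (snd \<circ> z) i" for z :: "int \<Rightarrow> 'a \<times> 'b" and i
    by (simp_all add: continuous_map_into_full_shift_iff)
  show "continuous_map full_shift_topology full_shift_topology (track_product (f, g))"
    unfolding continuous_map_into_full_shift_iff
  proof (intro ballI allI)
    fix z i
    show "\<forall>\<^sub>F y in nhdsin full_shift_topology z. track_product (f, g) y i = track_product (f, g) z i"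
      using ev(1)[of i z] ev(2)[of i z] by eventually_elim (simp add: track_product_def)
  qed
  show "track_product (f, g) \<circ> shift = shift \<circ> track_product (f, g)"
  proof (intro ext)
    fix z :: "int \<Rightarrow> 'a \<times> 'b" and i
    have "fst \<circ> shift z = shift (fst \<circ> z)" "snd \<circ> shift z = shift (snd \<circ> z)"
      by (simp_all add: shift_def fun_eq_iff)
    then show "(track_product (f, g) \<circ> shift) z i = (shift \<circ> track_product (f, g)) z i"
      by (simp add: track_product_def shift_apply cellular_automaton_shift f g)
  qed
qed

text \<open>Each factor can be read off, because any two configurations can be superimposed to one over
  the product alphabet.\<close>
lemma inj_track_product: "inj track_product"
proof (rule injI)
  fix p q :: "((int \<Rightarrow> 'a) \<Rightarrow> int \<Rightarrow> 'a) \<times> ((int \<Rightarrow> 'b) \<Rightarrow> int \<Rightarrow> 'b)"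
  assume eq: "track_product p = track_product q"
  have "fst p x i = fst q x i \<and> snd p y i = snd q y i" for x y i
    using fun_cong[OF fun_cong[OF eq, of "\<lambda>i. (x i, y i)"], of i]
    by (simp add: track_product_def comp_def)
  then show "p = q" by (simp add: prod_eq_iff fun_eq_iff)
qed

lemma DirProd_End_embeds:
  "(End_full_shift :: ((int \<Rightarrow> 'a::finite) \<Rightarrow> int \<Rightarrow> 'a) monoid) \<times>\<times>
   (End_full_shift :: ((int \<Rightarrow> 'b::finite) \<Rightarrow> int \<Rightarrow> 'b) monoid) \<le>\<^sub>m
   (End_full_shift :: ((int \<Rightarrow> 'a \<times> 'b) \<Rightarrow> int \<Rightarrow> 'a \<times> 'b) monoid)"
  unfolding embeds_in_def
proof (intro bexI conjI)
  show "track_product \<in> hom (End_full_shift \<times>\<times> End_full_shift) End_full_shift"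
    by (auto simp: hom_def DirProd_def End_full_shift_def cellular_automaton_track_product)
      (simp add: track_product_def fun_eq_iff comp_def)
qed (auto simp: DirProd_def End_full_shift_def track_product_def fun_eq_iff
      intro: inj_on_subset[OF inj_track_product])

theorem theorem1:
  fixes M :: "'b monoid" and N :: "'c monoid"
  assumes "CARD('a) \<ge> 2"
    and "monoid M" and "countable (carrier M)"
    and "monoid N" and "countable (carrier N)"
    and "M \<le>\<^sub>m (End_full_shift :: ((int \<Rightarrow> 'a::finite) \<Rightarrow> (int \<Rightarrow> 'a)) monoid)"
    and "N \<le>\<^sub>m (End_full_shift :: ((int \<Rightarrow> 'a) \<Rightarrow> (int \<Rightarrow> 'a)) monoid)"
  shows "M \<times>\<times> N \<le>\<^sub>m (End_full_shift :: ((int \<Rightarrow> 'a) \<Rightarrow> (int \<Rightarrow> 'a)) monoid)"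
proof -
  have "M \<times>\<times> N \<le>\<^sub>m (End_full_shift :: ((int \<Rightarrow> 'a) \<Rightarrow> int \<Rightarrow> 'a) monoid) \<times>\<times>
      (End_full_shift :: ((int \<Rightarrow> 'a) \<Rightarrow> int \<Rightarrow> 'a) monoid)"
    using assms(6,7) by (rule embeds_in_DirProd)
  also have
    "\<dots> \<le>\<^sub>m (End_full_shift :: ((int \<Rightarrow> 'a \<times> 'a) \<Rightarrow> int \<Rightarrow> 'a \<times> 'a) monoid)"
    by (rule DirProd_End_embeds)
  also have "\<dots> \<le>\<^sub>m (End_full_shift :: ((int \<Rightarrow> 'a) \<Rightarrow> int \<Rightarrow> 'a) monoid)"
    using assms(1) by (rule End_embeds_in_End)
  finally show ?thesis .
qed

end
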